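(* Let $-\infty<a<b<\infty$. A real sequence $\{\varepsilon_n\}_{n\ge0}$ is admissible for $[a,b]$ if and only if the normalized sequence $\{\gamma_n\}_{n\ge0}$ given by $$\gamma_n=\frac{n!\,\varepsilon_n}{(b-a)^n},\qquad n\ge 0,$$ has $\gamma_0=1$ and is completely monotone, that is, $$(-1)^k(\Delta^k\gamma)_n\ge 0,\qquad n,k\ge 0,$$ where the forward difference operator $\Delta$ is defined by $(\Delta\gamma)_n=\gamma_{n+1}-\gamma_n$ and $\Delta^k$ denotes its $k$-fold iterate.
   Context: For a cdf $F$ on $\mathbb{R}$ define $F^{(0)}:=F$ and recursively $F^{(-n)}(t):=\int_a^t F^{(-(n-1))}(x)\,dx$ for $n\ge 1$. A real sequence $\{\varepsilon_n\}_{n\ge0}$ is called admissible for $[a,b]$ if there exists a cdf $F$ with $F(a-)=0$ and $F(b)=1$ (where $F(a-)$ is the left limit at $a$) such that $\varepsilon_n=F^{(-n)}(b)$ for each $n\ge 0$. *)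

theory Defs
  imports "HOL-Probability.Probability"
begin

text \<open>
  \<open>iter_int a F n\<close> is \<open>F\<^sup>(\<^sup>-\<^sup>n\<^sup>)\<close>. The integral is the signed Lebesgue integral, so the
  function is defined on the whole real line, also to the left of \<open>a\<close>.
\<close>

primrec iter_int :: "real \<Rightarrow> (real \<Rightarrow> real) \<Rightarrow> nat \<Rightarrow> real \<Rightarrow> real" where
  "iter_int a F 0 = F"
| "iter_int a F (Suc n) = (\<lambda>t. LBINT x=ereal a..ereal t. iter_int a F n x)"

text \<open>
  A cdf is the distribution function \<^term>\<open>cdf M\<close> of a Borel probability measure \<open>M\<close> on the reals.
\<close>

definition admissible :: "real \<Rightarrow> real \<Rightarrow> (nat \<Rightarrow> real) \<Rightarrow> bool" where
  "admissible a b \<epsilon> \<longleftrightarrow>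
    (\<exists>M. real_distribution M \<and> (cdf M \<longlongrightarrow> 0) (at_left a) \<and> cdf M b = 1 \<and>
         (\<forall>n. \<epsilon> n = iter_int a (cdf M) n b))"

definition fwd_diff :: "(nat \<Rightarrow> real) \<Rightarrow> nat \<Rightarrow> real" where
  "fwd_diff \<gamma> n = \<gamma> (n + 1) - \<gamma> n"

definition completely_monotone :: "(nat \<Rightarrow> real) \<Rightarrow> bool" where
  "completely_monotone \<gamma> \<longleftrightarrow> (\<forall>n k. (-1) ^ k * (fwd_diff ^^ k) \<gamma> n \<ge> 0)"

end

theory Submission
  imports Defs
begin

text \<open>
  By Fubini, \<open>F\<^sup>(\<^sup>-\<^sup>n\<^sup>)(b)\<close> is the integral of \<open>(b - x)\<^sup>n / n!\<close> against \<open>dF\<close>, so \<open>\<gamma>\<close> is the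
  moment sequence of the image of \<open>dF\<close> under \<open>x \<mapsto> (b - x) / (b - a)\<close>, which maps \<open>[a, b]\<close> onto
  \<open>[0, 1]\<close>. This reduces the claim to the Hausdorff moment problem. Its hard direction puts mass
  \<open>(m choose k) (-1)\<^sup>m\<^sup>-\<^sup>k (\<Delta>\<^sup>m\<^sup>-\<^sup>k \<gamma>)\<^sub>k\<close> at the point \<open>k / m\<close>: the factorial moments of this measure
  reproduce \<open>\<gamma>\<close> exactly, the ordinary moments do so up to \<open>O(1 / m)\<close>, and a weakly convergent
  subsequence exists by Helly's theorem.
\<close>

section \<open>Iterated integrals of a cdf as moments\<close>

text \<open>Integrating \<open>(s - x) ^ n / fact n\<close> over \<open>s\<close> in
  \<open>{x..t}\<close> gives the same kernel with \<open>Suc n\<close>, so Fubini drives the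
  induction. Both inequalities in the condition are weak: at \<open>n = 0\<close> the kernel is 1
  even at \<open>x = t\<close>, and atoms at \<open>a\<close> and \<open>t\<close> must be counted
  as \<open>cdf M t\<close> counts them.\<close>

lemma iter_int_cdf:
  assumes "real_distribution M" and null: "measure M {..<a} = 0" and "a \<le> t"
  shows "iter_int a (cdf M) n t = (\<integral>x. (if a \<le> x \<and> x \<le> t then (t - x) ^ n / fact n else 0) \<partial>M)"
  using \<open>a \<le> t\<close>
proof (induction n arbitrary: t)
  case 0
  interpret real_distribution M by fact
  have "cdf M t = measure M ({..<a} \<union> {a..t})"
    using 0 by (simp add: cdf_def2 ivl_disj_un)
  also have "\<dots> = measure M {a..t}"
    using null by (subst finite_measure_Union) auto
  also have "\<dots> = (\<integral>x. indicator {a..t} x \<partial>M)"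
    by simp
  also have "\<dots> = (\<integral>x. (if a \<le> x \<and> x \<le> t then 1 else 0) \<partial>M)"
    by (intro Bochner_Integration.integral_cong) (auto simp: indicator_def)
  finally show ?case by (simp cong: if_cong)
next
  case (Suc n)
  interpret real_distribution M by fact
  interpret P: pair_sigma_finite M lborel ..
  \<comment> \<open>Building \<open>s \<le> t\<close> into the kernel confines it to a strip of
    finite product measure, where a bounded function is integrable.\<close>
  define g where "g x s = (if a \<le> x \<and> x \<le> s \<and> s \<le> t then (s - x) ^ n / fact n else 0)" for x s :: real
  have g_int: "integrable (M \<Otimes>\<^sub>M lborel) (case_prod g)"
  proof (rule integrableI_bounded_set[where A = "UNIV \<times> {a..t}" and B = "(t - a) ^ n / fact n"])
    show "case_prod g \<in> borel_measurable (M \<Otimes>\<^sub>M lborel)"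
      unfolding g_def by measurable
    have "emeasure (M \<Otimes>\<^sub>M lborel) (UNIV \<times> {a..t}) = emeasure M UNIV * emeasure lborel {a..t}"
      by (intro lborel.emeasure_pair_measure_Times) auto
    then show "emeasure (M \<Otimes>\<^sub>M lborel) (UNIV \<times> {a..t}) < \<infinity>"
      using Suc.prems emeasure_space_1 by (simp add: ennreal_mult_less_top)
    show "AE z in M \<Otimes>\<^sub>M lborel. z \<in> UNIV \<times> {a..t} \<longrightarrow> norm (case_prod g z) \<le> (t - a) ^ n / fact n"
      using Suc.prems by (intro AE_I2) (auto simp: g_def intro!: divide_right_mono power_mono)
  qed (auto simp: g_def split: if_splits)
  have inner: "(\<integral>s. g x s \<partial>lborel) = (if a \<le> x \<and> x \<le> t then (t - x) ^ Suc n / fact (Suc n) else 0)" for x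
  proof (cases "a \<le> x \<and> x \<le> t")
    case True
    have "(\<integral>s. g x s \<partial>lborel) = (\<integral>s. (s - x) ^ n / fact n * indicator {x..t} s \<partial>lborel)"
      using True by (intro Bochner_Integration.integral_cong) (auto simp: g_def indicator_def)
    also have "\<dots> = (t - x) ^ Suc n / fact (Suc n) - (x - x) ^ Suc n / fact (Suc n)"
    proof (rule integral_FTC_Icc_real)
      fix s :: real
      have "((\<lambda>s. s - x) has_real_derivative 1) (at s)"
        by (auto intro!: derivative_eq_intros)
      from DERIV_cdivide[OF DERIV_power_Suc[OF this, of n], of "fact (Suc n)"]
      show "((\<lambda>s. (s - x) ^ Suc n / fact (Suc n)) has_real_derivative (s - x) ^ n / fact n) (at s)"
        by (simp add: fact_Suc del: power_Suc)
    qed (use True in auto)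
    finally show ?thesis using True by simp
  qed (auto simp: g_def intro!: Bochner_Integration.integral_eq_zero_AE)
  have "iter_int a (cdf M) (Suc n) t = (\<integral>s. indicator {a..t} s * iter_int a (cdf M) n s \<partial>lborel)"
    using Suc.prems by (simp add: interval_integral_Icc set_lebesgue_integral_def)
  also have "\<dots> = (\<integral>s. (\<integral>x. g x s \<partial>M) \<partial>lborel)"
  proof (intro Bochner_Integration.integral_cong refl)
    fix s
    have "g x s = indicator {a..t} s * (if a \<le> x \<and> x \<le> s then (s - x) ^ n / fact n else 0)" for x
      by (auto simp: g_def indicator_def)
    then have "(\<integral>x. g x s \<partial>M) = indicator {a..t} s * (\<integral>x. (if a \<le> x \<and> x \<le> s then (s - x) ^ n / fact n else 0) \<partial>M)"
      by simp
    then show "indicator {a..t} s * iter_int a (cdf M) n s = (\<integral>x. g x s \<partial>M)"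
      \<comment> \<open>The induction hypothesis is available only for \<open>a \<le> s\<close>; to
        the left of \<open>a\<close> the indicator makes both sides zero.\<close>
      by (cases "a \<le> s") (simp_all add: Suc.IH)
  qed
  also have "\<dots> = (\<integral>x. (\<integral>s. g x s \<partial>lborel) \<partial>M)"
    by (rule P.Fubini_integral[OF g_int])
  finally show ?case
    by (simp add: inner)
qed

lemma iter_int_cdf_eq_moment:
  assumes "real_distribution M" and ae: "AE x in M. x \<in> {a..b}" and "a < b"
  shows "fact n * iter_int a (cdf M) n b / (b - a) ^ n = (\<integral>x. ((b - x) / (b - a)) ^ n \<partial>M)"
proof -
  interpret real_distribution M by fact
  have "measure M {..<a} = 0"
    using ae by (subst prob_eq_0) (auto elim!: eventually_mono)
  then have "iter_int a (cdf M) n b = (\<integral>x. (if a \<le> x \<and> x \<le> b then (b - x) ^ n / fact n else 0) \<partial>M)"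
    using \<open>a < b\<close> by (intro iter_int_cdf assms) auto
  also have "\<dots> = (\<integral>x. ((b - a) ^ n / fact n) * ((b - x) / (b - a)) ^ n \<partial>M)"
    using ae \<open>a < b\<close> by (intro integral_cong_AE) (auto simp: power_divide)
  finally show ?thesis
    using \<open>a < b\<close> by simp
qed

section \<open>Signed differences and binomial sums\<close>

abbreviation signed_diff :: "(nat \<Rightarrow> real) \<Rightarrow> nat \<Rightarrow> nat \<Rightarrow> real" where
  "signed_diff \<gamma> k n \<equiv> (-1) ^ k * (fwd_diff ^^ k) \<gamma> n"

lemma signed_diff_Suc: "signed_diff \<gamma> (Suc k) n = signed_diff \<gamma> k n - signed_diff \<gamma> k (Suc n)"
  by (simp add: fwd_diff_def algebra_simps)

text \<open>Each signed difference multiplies the integrand by \<open>1 - f x\<close>, because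
  \<open>f x ^ n - f x ^ Suc n = f x ^ n * (1 - f x)\<close>. For \<open>f\<close> with values in
  \<open>{0..1}\<close> this yields complete monotonicity.\<close>

lemma signed_diff_moment:
  assumes "\<And>n k. integrable M (\<lambda>x. f x ^ n * (1 - f x) ^ k)"
  shows "signed_diff (\<lambda>n. \<integral>x. f x ^ n \<partial>M) k n = (\<integral>x. f x ^ n * (1 - f x) ^ k \<partial>M)"
proof (induction k arbitrary: n)
  case (Suc k)
  have "signed_diff (\<lambda>n. \<integral>x. f x ^ n \<partial>M) (Suc k) n
      = (\<integral>x. f x ^ n * (1 - f x) ^ k - f x ^ Suc n * (1 - f x) ^ k \<partial>M)"
    unfolding signed_diff_Suc Suc.IH by (rule Bochner_Integration.integral_diff[OF assms assms, symmetric])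
  also have "\<dots> = (\<integral>x. f x ^ n * (1 - f x) ^ Suc k \<partial>M)"
    by (intro Bochner_Integration.integral_cong) (auto simp: algebra_simps)
  finally show ?case .
qed simp

text \<open>Pascal's rule, summed along a row against an arbitrary \<open>f\<close>.\<close>

lemma sum_binomial_Suc:
  fixes f :: "nat \<Rightarrow> real"
  shows "(\<Sum>i\<le>Suc r. real (Suc r choose i) * f i)
       = (\<Sum>i\<le>r. real (r choose i) * f i) + (\<Sum>i\<le>r. real (r choose i) * f (Suc i))"
proof -
  have "(\<Sum>i\<le>Suc r. real (Suc r choose i) * f i)
      = f 0 + (\<Sum>i\<le>r. real (r choose Suc i) * f (Suc i)) + (\<Sum>i\<le>r. real (r choose i) * f (Suc i))"
    by (subst sum.atMost_Suc_shift) (simp add: sum.distrib algebra_simps)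
  also have "f 0 + (\<Sum>i\<le>r. real (r choose Suc i) * f (Suc i)) = (\<Sum>i\<le>Suc r. real (r choose i) * f i)"
    by (subst sum.atMost_Suc_shift) simp
  finally show ?thesis by simp
qed

text \<open>With E the shift operator, the signed difference is 1 - E, and the sum is the binomial
  expansion of (E + (1 - E))^r = 1 applied to \<gamma>. The induction combines Pascal's rule with
  \<open>signed_diff_Suc\<close> read from right to left.\<close>

lemma sum_binomial_signed_diff:
  "(\<Sum>i\<le>r. real (r choose i) * signed_diff \<gamma> (r - i) (n + i)) = \<gamma> n"
proof (induction r)
  case (Suc r)
  have "(\<Sum>i\<le>Suc r. real (Suc r choose i) * signed_diff \<gamma> (Suc r - i) (n + i))
      = (\<Sum>i\<le>r. real (r choose i) * (signed_diff \<gamma> (Suc r - i) (n + i) + signed_diff \<gamma> (r - i) (Suc (n + i))))"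
    by (subst sum_binomial_Suc) (simp add: sum.distrib distrib_left)
  also have "\<dots> = (\<Sum>i\<le>r. real (r choose i) * signed_diff \<gamma> (r - i) (n + i))"
  proof (intro sum.cong refl arg_cong2[where f = "(*)"])
    fix i assume "i \<in> {..r}"
    then have "Suc r - i = Suc (r - i)" by auto
    then show "signed_diff \<gamma> (Suc r - i) (n + i) + signed_diff \<gamma> (r - i) (Suc (n + i)) = signed_diff \<gamma> (r - i) (n + i)"
      using signed_diff_Suc[of "r - i" \<gamma> "n + i"] by simp
  qed
  finally show ?case using Suc.IH by simp
qed simp

section \<open>Discrete approximating measures and their moments\<close>

text \<open>If \<gamma> is the moment sequence of a measure on \<open>{0..1}\<close>, this is the
  integral of the Bernstein basis polynomial of degree \<open>m\<close> and index \<open>k\<close>,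
  by \<open>signed_diff_moment\<close>.\<close>

definition hausdorff_weight :: "(nat \<Rightarrow> real) \<Rightarrow> nat \<Rightarrow> nat \<Rightarrow> real" where
  "hausdorff_weight \<gamma> m k = real (m choose k) * signed_diff \<gamma> (m - k) k"

text \<open>Trinomial revision cancels \<open>m choose j\<close> and leaves
  \<open>sum_binomial_signed_diff\<close> for row \<open>m - j\<close> started at index
  \<open>j\<close>. The case \<open>j = 0\<close> says that the total mass is
  \<open>\<gamma> 0\<close>.\<close>

lemma sum_hausdorff_weight:
  assumes "j \<le> m"
  shows "(\<Sum>k\<le>m. hausdorff_weight \<gamma> m k * (real (k choose j) / real (m choose j))) = \<gamma> j"
proof -
  have "(\<Sum>k\<le>m. hausdorff_weight \<gamma> m k * (real (k choose j) / real (m choose j)))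
      = (\<Sum>k\<in>{j..m}. hausdorff_weight \<gamma> m k * (real (k choose j) / real (m choose j)))"
    by (intro sum.mono_neutral_right) (auto simp: binomial_eq_0)
  also have "\<dots> = (\<Sum>k\<in>{j..m}. real ((m - j) choose (k - j)) * signed_diff \<gamma> (m - k) k)"
  proof (intro sum.cong refl)
    fix k assume k: "k \<in> {j..m}"
    have "real (m choose k) * real (k choose j) = real (m choose j) * real ((m - j) choose (k - j))"
      using k choose_mult[of j k m] by (metis of_nat_mult atLeastAtMost_iff)
    then have *: "real (m choose k) * (real (k choose j) / real (m choose j)) = real ((m - j) choose (k - j))"
      using assms by (simp add: field_simps)
    show "hausdorff_weight \<gamma> m k * (real (k choose j) / real (m choose j))
        = real ((m - j) choose (k - j)) * signed_diff \<gamma> (m - k) k"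
      unfolding hausdorff_weight_def *[symmetric] by (simp only: mult_ac)
  qed
  also have "\<dots> = (\<Sum>i\<le>m - j. real ((m - j) choose i) * signed_diff \<gamma> (m - j - i) (j + i))"
    using assms by (intro sum.reindex_bij_witness[of _ "\<lambda>i. j + i" "\<lambda>k. k - j"]) auto
  also have "\<dots> = \<gamma> j"
    by (rule sum_binomial_signed_diff)
  finally show ?thesis .
qed

text \<open>A ratio of falling factorials, written as \<open>j\<close> factors so that it can be
  compared with \<open>(k / m) ^ j\<close> factor by factor.\<close>

lemma binomial_quotient_eq_prod:
  assumes "j \<le> m"
  shows "real (k choose j) / real (m choose j) = (\<Prod>i<j. real (k - i) / real (m - i))"
proof -
  have *: "real (N choose j) * fact j = (\<Prod>i<j. real (N - i))" for N
  proof (cases "j \<le> N")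
    case True
    have "fact j * real (N choose j) = (\<Prod>i<j. real N - real i)"
      by (simp add: binomial_gbinomial gbinomial_mult_fact atLeast0LessThan)
    also have "\<dots> = (\<Prod>i<j. real (N - i))"
      using True by (intro prod.cong) (auto simp: of_nat_diff)
    finally show ?thesis by (simp add: mult.commute)
  next
    case False
    \<comment> \<open>For \<open>N < j\<close> the product contains the factor with index
      \<open>N\<close>, which is zero like the binomial coefficient.\<close>
    then show ?thesis by (auto simp: binomial_eq_0 intro!: bexI[of _ N])
  qed
  have "real (k choose j) / real (m choose j) = (real (k choose j) * fact j) / (real (m choose j) * fact j)"
    by simp
  then show ?thesis
    by (simp only: * prod_dividef)
qed

text \<open>Both terms are products of \<open>j\<close> factors in \<open>{0..1}\<close>, so they
  differ by at most the sum of the factorwise differences. Each of these is at most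
  \<open>j / m\<close>.\<close>

lemma binomial_quotient_approx:
  assumes "j \<le> m" "k \<le> m"
  shows "\<bar>(real k / real m) ^ j - real (k choose j) / real (m choose j)\<bar> \<le> real j ^ 2 / real m"
proof -
  have le: "\<bar>real k / real m - real (k - i) / real (m - i)\<bar> \<le> real j / real m" if "i < j" for i
  proof (cases "k \<le> i")
    case True
    then show ?thesis using that by (auto intro!: divide_right_mono)
  next
    case False
    have m: "real m > 0" "real m - real i > 0" using assms that False by auto
    \<comment> \<open>The fraction \<open>(m - k) / (m - i)\<close> on the right lies in
      \<open>{0..1}\<close> because \<open>i < k \<le> m\<close>, which leaves a bound of
      \<open>i / m\<close>.\<close>
    have "real k / real m - real (k - i) / real (m - i) = real i * ((real m - real k) / (real m - real i)) / real m"
      using m False assms that by (simp add: field_simps of_nat_diff)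
    moreover have "0 \<le> (real m - real k) / (real m - real i)" "(real m - real k) / (real m - real i) \<le> 1"
      using m False assms by auto
    then have "0 \<le> real i * ((real m - real k) / (real m - real i))" "real i * ((real m - real k) / (real m - real i)) \<le> real i * 1"
      using mult_left_mono[of "(real m - real k) / (real m - real i)" 1 "real i"]
      by (simp_all del: times_divide_eq_right)
    moreover have "real i \<le> real j" using that by simp
    ultimately show ?thesis
      by (simp add: divide_right_mono del: times_divide_eq_right)
  qed
  have diff: "(real k / real m) ^ j - real (k choose j) / real (m choose j)
      = (\<Prod>i<j. real k / real m) - (\<Prod>i<j. real (k - i) / real (m - i))"
    using assms by (simp add: binomial_quotient_eq_prod)
  have "\<bar>(real k / real m) ^ j - real (k choose j) / real (m choose j)\<bar>
      \<le> (\<Sum>i<j. \<bar>real k / real m - real (k - i) / real (m - i)\<bar>)"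
    unfolding diff real_norm_def[symmetric]
    by (rule norm_prod_diff) (use assms in \<open>auto simp: divide_le_eq_1\<close>)
  also have "\<dots> \<le> (\<Sum>i<j. real j / real m)"
    by (intro sum_mono le) auto
  finally show ?thesis by (simp add: power2_eq_square)
qed

text \<open>Complete monotonicity makes the weights nonnegative with total
  \<open>\<gamma> 0\<close>, so passing from factorial to ordinary moments costs at most
  \<open>\<gamma> 0 * (j ^ 2 / m)\<close>.\<close>

lemma tendsto_hausdorff_moments:
  assumes cm: "completely_monotone \<gamma>"
  shows "(\<lambda>m. \<Sum>k\<le>m. hausdorff_weight \<gamma> m k * (real k / real m) ^ j) \<longlonglongrightarrow> \<gamma> j"
proof -
  have nonneg: "hausdorff_weight \<gamma> m k \<ge> 0" for m k
    using cm unfolding completely_monotone_def hausdorff_weight_def by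
      (intro mult_nonneg_nonneg[OF of_nat_0_le_iff]) simp
  have total: "(\<Sum>k\<le>m. hausdorff_weight \<gamma> m k) = \<gamma> 0" for m
    using sum_hausdorff_weight[of 0 m \<gamma>] by simp
  have "(\<lambda>m. (\<Sum>k\<le>m. hausdorff_weight \<gamma> m k * (real k / real m) ^ j) - \<gamma> j) \<longlonglongrightarrow> 0"
  proof (rule Lim_null_comparison)
    show "\<forall>\<^sub>F m in sequentially. norm ((\<Sum>k\<le>m. hausdorff_weight \<gamma> m k * (real k / real m) ^ j) - \<gamma> j)
        \<le> \<gamma> 0 * (real j ^ 2 / real m)"
    proof (rule eventually_sequentiallyI[of j])
      fix m assume m: "j \<le> m"
      \<comment> \<open>Expanding \<open>\<gamma> j\<close> backwards into its factorial moment sum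
        lets the two sums merge term by term.\<close>
      have diff: "(\<Sum>k\<le>m. hausdorff_weight \<gamma> m k * (real k / real m) ^ j) - \<gamma> j
          = (\<Sum>k\<le>m. hausdorff_weight \<gamma> m k * ((real k / real m) ^ j - real (k choose j) / real (m choose j)))"
        by (simp add: right_diff_distrib sum_subtractf sum_hausdorff_weight[OF m, of \<gamma>, symmetric])
      have "\<bar>(\<Sum>k\<le>m. hausdorff_weight \<gamma> m k * (real k / real m) ^ j) - \<gamma> j\<bar>
          \<le> (\<Sum>k\<le>m. \<bar>hausdorff_weight \<gamma> m k * ((real k / real m) ^ j - real (k choose j) / real (m choose j))\<bar>)"
        unfolding diff by (rule sum_abs)
      also have "\<dots> \<le> (\<Sum>k\<le>m. hausdorff_weight \<gamma> m k * (real j ^ 2 / real m))"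
      proof (rule sum_mono)
        fix k assume "k \<in> {..m}"
        then have "\<bar>(real k / real m) ^ j - real (k choose j) / real (m choose j)\<bar> \<le> real j ^ 2 / real m"
          using m by (intro binomial_quotient_approx) auto
        from mult_left_mono[OF this nonneg[of m k]]
        show "\<bar>hausdorff_weight \<gamma> m k * ((real k / real m) ^ j - real (k choose j) / real (m choose j))\<bar>
            \<le> hausdorff_weight \<gamma> m k * (real j ^ 2 / real m)"
          by (simp only: abs_mult abs_of_nonneg[OF nonneg])
      qed
      also have "\<dots> = \<gamma> 0 * (real j ^ 2 / real m)"
        by (simp only: sum_distrib_right[symmetric] total)
      finally show "norm ((\<Sum>k\<le>m. hausdorff_weight \<gamma> m k * (real k / real m) ^ j) - \<gamma> j)
          \<le> \<gamma> 0 * (real j ^ 2 / real m)" by (simp only: real_norm_def)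
    qed
    show "(\<lambda>m. \<gamma> 0 * (real j ^ 2 / real m)) \<longlonglongrightarrow> 0"
      by (intro tendsto_mult_right_zero lim_const_over_n)
  qed
  then show ?thesis by (rule LIM_zero_cancel)
qed

section \<open>Weak limits of measures on the unit interval\<close>

text \<open>A common compact support gives tightness, hence a weakly convergent subsequence. The
  limit must then be shown to live on \<open>{0..1}\<close> too, after which powers may serve as
  test functions.\<close>

lemma convergent_subsequence_unit_interval:
  assumes rd: "\<And>m. real_distribution (\<mu> m)" and ae: "\<And>m. AE x in \<mu> m. x \<in> {0..1}"
  obtains r M where "strict_mono (r :: nat \<Rightarrow> nat)" "real_distribution M" "AE x in M. x \<in> {0..1::real}"
    "\<And>n. (\<lambda>m. \<integral>x. x ^ n \<partial>\<mu> (r m)) \<longlonglongrightarrow> (\<integral>x. x ^ n \<partial>M)"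
proof -
  have "tight \<mu>"
    unfolding tight_def
  proof (intro conjI allI impI rd)
    fix e :: real assume "e > 0"
    \<comment> \<open>Tightness is stated with intervals open on the left, so the left end lies
      below 0 to keep a possible atom at 0.\<close>
    have "measure (\<mu> m) {-1<..1} = 1" for m
    proof -
      interpret real_distribution "\<mu> m" by (rule rd)
      show ?thesis by (subst prob_eq_1) (use ae[of m] in auto)
    qed
    then show "\<exists>a b. a < b \<and> (\<forall>m. 1 - e < measure (\<mu> m) {a<..b})"
      using \<open>e > 0\<close> by (intro exI[of _ "-1"] exI[of _ 1]) auto
  qed
  from tight_imp_convergent_subsubsequence[OF this strict_mono_id] obtain r M where
    r: "strict_mono r" and M: "real_distribution M" and conv: "weak_conv_m (\<mu> \<circ> id \<circ> r) M"
    by auto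
  interpret M: real_distribution M by (rule M)
  \<comment> \<open>Weak convergence only tests bounded continuous functions, so powers are composed
    with a retraction onto the unit interval.\<close>
  define p where "p x = max 0 (min 1 x)" for x :: real
  have p_cont[continuous_intros]: "isCont p x" for x
    unfolding p_def by (intro continuous_intros)
  have p_meas[measurable]: "p \<in> borel_measurable borel"
    unfolding p_def by measurable
  have p_range: "p x \<in> {0..1}" for x
    by (auto simp: p_def)
  have p_id: "x \<in> {0..1} \<Longrightarrow> p x = x" for x
    by (auto simp: p_def)
  have lim: "(\<lambda>m. \<integral>x. f x \<partial>\<mu> (r m)) \<longlonglongrightarrow> (\<integral>x. f x \<partial>M)"
    if "\<And>x. isCont f x" "\<And>x. \<bar>f x\<bar> \<le> 1" for f :: "real \<Rightarrow> real"
    using weak_conv_imp_integral_bdd_continuous_conv[of "\<mu> \<circ> id \<circ> r" M f 1] rd M conv that by simp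
  \<comment> \<open>The distance to \<open>{0..1}\<close>, capped at 1, is a bounded continuous
    function vanishing exactly there. Its integrals are zero along the sequence, hence zero in the
    limit, which yields the support of \<open>M\<close>.\<close>
  define d where "d x = min 1 \<bar>x - p x\<bar>" for x :: real
  have d_meas[measurable]: "d \<in> borel_measurable borel"
    unfolding d_def by measurable
  have "(\<lambda>m. \<integral>x. d x \<partial>\<mu> (r m)) \<longlonglongrightarrow> (\<integral>x. d x \<partial>M)"
    unfolding d_def by (intro lim continuous_intros) auto
  moreover have "(\<integral>x. d x \<partial>\<mu> (r m)) = 0" for m
    by (intro integral_eq_zero_AE eventually_mono[OF ae]) (simp add: d_def p_id)
  ultimately have "(\<integral>x. d x \<partial>M) = 0"
    by (simp add: LIMSEQ_const_iff)
  moreover have "integrable M d"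
    by (intro M.integrable_const_bound[where B = 1]) (auto simp: d_def)
  ultimately have "AE x in M. d x = 0"
    by (subst (asm) integral_nonneg_eq_0_iff_AE) (auto simp: d_def)
  then have ae_M: "AE x in M. x \<in> {0..1}"
  proof (rule eventually_mono)
    fix x assume "d x = 0"
    then have "x = p x" by (auto simp: d_def min_def split: if_splits)
    then show "x \<in> {0..1}" using p_range[of x] by simp
  qed
  have clip: "(\<integral>x. p x ^ n \<partial>N) = (\<integral>x. x ^ n \<partial>N)" if "real_distribution N" "AE x in N. x \<in> {0..1}" for N n
  proof -
    interpret real_distribution N by fact
    show ?thesis by (intro integral_cong_AE eventually_mono[OF that(2)]) (auto simp: p_id)
  qed
  have "(\<lambda>m. \<integral>x. x ^ n \<partial>\<mu> (r m)) \<longlonglongrightarrow> (\<integral>x. x ^ n \<partial>M)" for n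
  proof -
    have "(\<lambda>m. \<integral>x. p x ^ n \<partial>\<mu> (r m)) \<longlonglongrightarrow> (\<integral>x. p x ^ n \<partial>M)"
      using p_range by (intro lim continuous_intros) (auto simp: power_abs intro!: power_le_one)
    then show ?thesis
      by (simp only: clip rd ae M ae_M)
  qed
  with r M ae_M show thesis by (rule that)
qed

section \<open>The Hausdorff moment problem\<close>

theorem hausdorff_moment_problem:
  assumes "\<gamma> 0 = 1" and cm: "completely_monotone \<gamma>"
  obtains M where "real_distribution M" "AE x in M. x \<in> {0..1::real}"
    "\<And>n. \<gamma> n = (\<integral>x. x ^ n \<partial>M)"
proof -
  define w where "w m k = (if k \<le> m then hausdorff_weight \<gamma> m k else 0)" for m k
  have w_nonneg: "w m k \<ge> 0" for m k
    using cm unfolding completely_monotone_def hausdorff_weight_def w_def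
    by (auto intro!: mult_nonneg_nonneg[OF of_nat_0_le_iff])
  have w_prob: "(\<integral>\<^sup>+k. ennreal (w m k) \<partial>count_space UNIV) = 1" for m
  proof -
    have "(\<integral>\<^sup>+k. ennreal (w m k) \<partial>count_space UNIV) = (\<Sum>k\<le>m. ennreal (w m k))"
      by (intro nn_integral_count_space') (auto simp: w_def)
    also have "\<dots> = ennreal (\<Sum>k\<le>m. w m k)"
      by (intro sum_ennreal w_nonneg)
    also have "(\<Sum>k\<le>m. w m k) = 1"
      using sum_hausdorff_weight[of 0 m \<gamma>] assms(1) by (simp add: w_def)
    finally show ?thesis by simp
  qed
  define q where "q m = embed_pmf (w m)" for m
  have pmf_q: "pmf (q m) k = w m k" for m k
    unfolding q_def by (intro pmf_embed_pmf w_nonneg w_prob)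
  have set_q: "set_pmf (q m) \<subseteq> {..m}" for m
    by (auto simp: set_pmf_eq pmf_q w_def)
  define \<mu> where "\<mu> m = distr (measure_pmf (q m)) borel (\<lambda>k. real k / real m)" for m
  have rd: "real_distribution (\<mu> m)" for m
    unfolding \<mu>_def real_distribution_def real_distribution_axioms_def
    by (auto intro!: measure_pmf.prob_space_distr)
  \<comment> \<open>This covers \<open>m = 0\<close> as well: the only point is then
    \<open>0 / 0 = 0\<close>.\<close>
  have ae: "AE x in \<mu> m. x \<in> {0..1}" for m
    unfolding \<mu>_def using set_q[of m]
    by (subst AE_distr_iff) (auto simp: AE_measure_pmf_iff divide_le_eq_1)
  have mom: "(\<integral>x. x ^ n \<partial>\<mu> m) = (\<Sum>k\<le>m. hausdorff_weight \<gamma> m k * (real k / real m) ^ n)" for m n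
  proof -
    have "(\<integral>x. x ^ n \<partial>\<mu> m) = (\<integral>k. (real k / real m) ^ n \<partial>measure_pmf (q m))"
      unfolding \<mu>_def by (subst integral_distr) auto
    also have "\<dots> = (\<Sum>k\<le>m. (real k / real m) ^ n * pmf (q m) k)"
      using set_q[of m] by (intro integral_measure_pmf_real) auto
    finally show ?thesis by (simp add: pmf_q w_def mult.commute)
  qed
  obtain r M where r: "strict_mono r" and M: "real_distribution M" "AE x in M. x \<in> {0..1}"
    and lim: "\<And>n. (\<lambda>m. \<integral>x. x ^ n \<partial>\<mu> (r m)) \<longlonglongrightarrow> (\<integral>x. x ^ n \<partial>M)"
    by (rule convergent_subsequence_unit_interval[of \<mu>, OF rd ae]) (rule that)
  have "\<gamma> n = (\<integral>x. x ^ n \<partial>M)" for n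
  \<comment> \<open>The moments converge to \<open>\<gamma> n\<close> along the full sequence, hence
    also along the subsequence \<open>r\<close>.\<close>
  proof (rule LIMSEQ_unique)
    show "(\<lambda>m. \<integral>x. x ^ n \<partial>\<mu> (r m)) \<longlonglongrightarrow> \<gamma> n"
      using LIMSEQ_subseq_LIMSEQ[OF tendsto_hausdorff_moments[OF cm, of n] r] by (simp add: mom comp_def)
  qed (rule lim)
  with M show thesis by (rule that)
qed

section \<open>Transfer between \<open>{a..b}\<close> and the unit interval\<close>

text \<open>The left limit of \<open>cdf M\<close> at \<open>a\<close> is the mass of
  \<open>{..<a}\<close> and \<open>cdf M b\<close> is the mass of \<open>{..b}\<close>, so the two
  boundary conditions together say that \<open>M\<close> is carried by \<open>{a..b}\<close>. Atoms
  at both endpoints remain possible.\<close>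

lemma admissible_iff_AE:
  "admissible a b \<epsilon> \<longleftrightarrow>
    (\<exists>M. real_distribution M \<and> (AE x in M. x \<in> {a..b}) \<and> (\<forall>n. \<epsilon> n = iter_int a (cdf M) n b))"
proof -
  have "(cdf M \<longlongrightarrow> 0) (at_left a) \<and> cdf M b = 1 \<longleftrightarrow> (AE x in M. x \<in> {a..b})" if "real_distribution M" for M
  proof -
    interpret real_distribution M by fact
    have "(cdf M \<longlongrightarrow> 0) (at_left a) \<longleftrightarrow> measure M {..<a} = 0"
      using cdf_at_left[of a] tendsto_unique[of "at_left a" "cdf M" "measure M {..<a}" 0] by auto
    also have "\<dots> \<longleftrightarrow> (AE x in M. x \<notin> {..<a})"
      by (rule prob_eq_0) simp
    finally have lower: "(cdf M \<longlongrightarrow> 0) (at_left a) \<longleftrightarrow> (AE x in M. a \<le> x)"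
      by (simp add: not_less)
    have upper: "cdf M b = 1 \<longleftrightarrow> (AE x in M. x \<le> b)"
      unfolding cdf_def2 by (subst prob_eq_1) simp_all
    show ?thesis
      unfolding lower upper by (simp add: AE_conj_iff)
  qed
  then show ?thesis
    unfolding admissible_def by (intro ex_cong1) blast
qed

theorem theorem2:
  fixes a b :: real and \<epsilon> \<gamma> :: "nat \<Rightarrow> real"
  assumes "a < b"
    and "\<And>n. \<gamma> n = fact n * \<epsilon> n / (b - a) ^ n"
  shows "admissible a b \<epsilon> \<longleftrightarrow> \<gamma> 0 = 1 \<and> completely_monotone \<gamma>"
proof
  assume "admissible a b \<epsilon>"
  then obtain M where M: "real_distribution M" and ae: "AE x in M. x \<in> {a..b}"
    and eps: "\<And>n. \<epsilon> n = iter_int a (cdf M) n b"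
    unfolding admissible_iff_AE by blast
  interpret real_distribution M by fact
  define f where "f x = (b - x) / (b - a)" for x
  have f_meas[measurable]: "f \<in> borel_measurable borel"
    unfolding f_def by measurable
  have "x \<in> {a..b} \<Longrightarrow> f x \<in> {0..1}" for x
    using \<open>a < b\<close> by (auto simp: f_def)
  then have f_ae: "AE x in M. f x \<in> {0..1}"
    by (rule eventually_mono[OF ae])
  have moment: "\<gamma> = (\<lambda>n. \<integral>x. f x ^ n \<partial>M)"
    using iter_int_cdf_eq_moment[OF M ae \<open>a < b\<close>] assms(2) eps by (auto simp: f_def)
  \<comment> \<open>Only almost everywhere, since \<open>f\<close> leaves \<open>{0..1}\<close>
    outside \<open>{a..b}\<close>.\<close>
  have bound: "AE x in M. 0 \<le> f x ^ n * (1 - f x) ^ k \<and> f x ^ n * (1 - f x) ^ k \<le> 1" for n k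
    using f_ae by (rule eventually_mono) (auto intro!: mult_le_one power_le_one)
  have int: "integrable M (\<lambda>x. f x ^ n * (1 - f x) ^ k)" for n k
    by (rule integrable_const_bound[where B = 1]) (auto intro: eventually_mono[OF bound[of n k]])
  have "signed_diff \<gamma> k n \<ge> 0" for n k
    unfolding moment signed_diff_moment[where f = f and M = M, OF int]
    by (intro integral_nonneg_AE) (rule eventually_mono[OF bound[of n k]], simp)
  moreover have "\<gamma> 0 = 1"
    using prob_space by (simp add: moment)
  ultimately show "\<gamma> 0 = 1 \<and> completely_monotone \<gamma>"
    by (simp add: completely_monotone_def)
next
  assume "\<gamma> 0 = 1 \<and> completely_monotone \<gamma>"
  then obtain N where N: "real_distribution N" and ae_N: "AE x in N. x \<in> {0..1::real}"
    and moment: "\<And>n. \<gamma> n = (\<integral>x. x ^ n \<partial>N)"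
    using hausdorff_moment_problem by blast
  interpret N: real_distribution N by fact
  \<comment> \<open>The map is the inverse of \<open>x \<mapsto> (b - x) / (b - a)\<close>, so the
    normalized moments of \<open>M\<close> are the moments of \<open>N\<close>.\<close>
  define M where "M = distr N borel (\<lambda>u. b - (b - a) * u)"
  have M: "real_distribution M"
    unfolding M_def by (intro N.real_distribution_distr) auto
  have "b - (b - a) * u \<in> {a..b}" if "u \<in> {0..1}" for u
  proof -
    have "0 \<le> (b - a) * u" "(b - a) * u \<le> (b - a) * 1"
      using that \<open>a < b\<close> by (intro mult_nonneg_nonneg mult_left_mono; simp)+
    then show ?thesis by simp
  qed
  then have ae: "AE x in M. x \<in> {a..b}"
    unfolding M_def by (subst AE_distr_iff) (auto intro: eventually_mono[OF ae_N])
  have "(\<integral>x. ((b - x) / (b - a)) ^ n \<partial>M) = (\<integral>u. u ^ n \<partial>N)" for n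
    unfolding M_def using \<open>a < b\<close> by (subst integral_distr) auto
  then have "fact n * \<epsilon> n / (b - a) ^ n = fact n * iter_int a (cdf M) n b / (b - a) ^ n" for n
    using iter_int_cdf_eq_moment[OF M ae \<open>a < b\<close>, of n] moment[of n] assms(2)[of n] by simp
  \<comment> \<open>The normalizing factor \<open>fact n / (b - a) ^ n\<close> is nonzero and
    cancels.\<close>
  then have "\<epsilon> n = iter_int a (cdf M) n b" for n
    using \<open>a < b\<close> by simp
  with M ae show "admissible a b \<epsilon>"
    unfolding admissible_iff_AE by blast
qed

end
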